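(* Work in ZF (without assuming the axiom of choice). Suppose that every well-specified game has a pure-strategy Nash equilibrium. Then the axiom of choice holds: for every family $(X_i)_{i\in I}$ of nonempty sets, the Cartesian product $\prod_{i\in I}X_i$ is nonempty.
   Context: Hyperspace: for a topological space $X$, $C(X)$ denotes the set of nonempty closed subsets of $X$, equipped with the upper Vietoris topology, which has as a basis the sets $\{K\in C(X)\colon K\subset U\}$ with $U\subset X$ open. Preregular: two points of a topological space are topologically distinguishable if there is an open set containing one but not the other; a space is preregular if any two topologically distinguishable points can be separated by disjoint open neighborhoods. Compact does not include Hausdorff. Game: a family of nonempty topological spaces $(S_i)_{i\in I}$ (strategy spaces), indexed by a possibly infinite set $I$ containing at least two elements, together with, for each $i\in I$, a best-response correspondence, which is a continuous function $\mathrm{BR}_i\colon S_{-i}\to C(S_i)$. Here $S=\prod_{i\in I}S_i$ and $S_{-i}=\prod_{j\neq i}S_j$ carry the product topologies; without choice these products are defined but are not assumed to be nonempty. For $s\in S$, $s_i$ is its $i$th coordinate and $s_{-i}\in S_{-i}$ is $s$ with the $i$th coordinate removed. Pure-strategy Nash equilibrium: a point $s\in S$ with $s_i\in \mathrm{BR}_i(s_{-i})$ for every $i\in I$. Reduction: for $J\subset I$ with at least two elements, let $S_J=\prod_{i\in J}S_i$ and $S_{-J}=\prod_{i\in I\setminus J}S_i$. For a point $p\in S_{-J}$, the reduction around $p$ is the game with index set $J$, strategy spaces $S_i$ ($i\in J$), and best-response correspondences $\mathrm{BR}_i(p,\cdot)\colon \prod_{j\in J\setminus\{i\}}S_j\to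 C(S_i)$ ($i\in J$), i.e. the players outside $J$ have their strategies fixed to be those given by $p$. If $J=I$, the unique corresponding reduction is the original game. A reduction is finite if $J$ is finite. Well-specified: a game is well-specified if (1) each $S_i$ is nonempty, preregular, and compact; (2) each best-response correspondence $\mathrm{BR}_i$ is continuous; and (3) every finite reduction has a pure-strategy Nash equilibrium. *)

theory Defs
  imports Main
begin

text \<open>
  HOL proves the axiom of choice, so a statement about ZF without choice has to be about models of
  ZF. A structure for the language of set theory is a type 'a with a binary relation \<open>mem\<close>. All
  notions below (functions, finiteness, topologies, games, ...) are those of the structure: every
  set, function, open cover, game, and so on is an element of 'a, and all quantifiers range over 'a.
  By the completeness theorem, what holds in all models of ZF is what ZF proves.
\<close>

subsection \<open>First-order formulas of set theory\<close>

datatype fm = Member nat nat | Equal nat nat | Neg fm | Conj fm fm | All nat fm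

primrec sat :: "('a \<Rightarrow> 'a \<Rightarrow> bool) \<Rightarrow> (nat \<Rightarrow> 'a) \<Rightarrow> fm \<Rightarrow> bool" where
  "sat E v (Member m n) \<longleftrightarrow> E (v m) (v n)"
| "sat E v (Equal m n) \<longleftrightarrow> v m = v n"
| "sat E v (Neg \<phi>) \<longleftrightarrow> \<not> sat E v \<phi>"
| "sat E v (Conj \<phi> \<psi>) \<longleftrightarrow> sat E v \<phi> \<and> sat E v \<psi>"
| "sat E v (All n \<phi>) \<longleftrightarrow> (\<forall>x. sat E (v(n := x)) \<phi>)"

subsection \<open>Models of ZF\<close>

text \<open>
  In the two schemes, the valuation \<open>v\<close> supplies the parameters of the formula \<open>\<phi>\<close>; only formulas of
  the object language are allowed, so the schemes do not import choice from HOL.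
\<close>

locale ZF =
  fixes mem :: "'a \<Rightarrow> 'a \<Rightarrow> bool"
  assumes extensionality: "\<And>a b. (\<And>x. mem x a \<longleftrightarrow> mem x b) \<Longrightarrow> a = b"
    and foundation: "\<And>a. \<exists>x. mem x a \<Longrightarrow> \<exists>x. mem x a \<and> (\<forall>y. mem y x \<longrightarrow> \<not> mem y a)"
    and pairing: "\<And>a b. \<exists>c. \<forall>x. mem x c \<longleftrightarrow> x = a \<or> x = b"
    and union: "\<And>a. \<exists>b. \<forall>x. mem x b \<longleftrightarrow> (\<exists>y. mem y a \<and> mem x y)"
    and power_set: "\<And>a. \<exists>b. \<forall>x. mem x b \<longleftrightarrow> (\<forall>y. mem y x \<longrightarrow> mem y a)"
    and infinity: "\<exists>w. (\<exists>e. mem e w \<and> (\<forall>x. \<not> mem x e)) \<and>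
      (\<forall>x. mem x w \<longrightarrow> (\<exists>y. mem y w \<and> (\<forall>z. mem z y \<longleftrightarrow> mem z x \<or> z = x)))"
    and separation: "\<And>\<phi> v a. \<exists>b. \<forall>x. mem x b \<longleftrightarrow> mem x a \<and> sat mem (v(0 := x)) \<phi>"
    and replacement: "\<And>\<phi> v a.
      (\<And>x y z. mem x a \<Longrightarrow> sat mem (v(0 := x, 1 := y)) \<phi> \<Longrightarrow> sat mem (v(0 := x, 1 := z)) \<phi> \<Longrightarrow> y = z)
      \<Longrightarrow> \<exists>b. \<forall>y. mem y b \<longleftrightarrow> (\<exists>x. mem x a \<and> sat mem (v(0 := x, 1 := y)) \<phi>)"

text \<open>
  A game is a tuple of elements of the structure: the index set, and the families (functions of the
  structure on the index set) of strategy sets, of their topologies, and of best responses.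
\<close>

record 'a game =
  players :: 'a
  strategies :: 'a
  opens :: 'a
  best_response :: 'a

locale membership =
  fixes mem :: "'a \<Rightarrow> 'a \<Rightarrow> bool"
begin

subsection \<open>Sets and functions\<close>

definition elts :: "'a \<Rightarrow> 'a set" where
  "elts a = {x. mem x a}"

text \<open>
  The element of the structure with the given members. This is meaningful only if there is one;
  for each use below, ZF proves that there is.
\<close>

definition as_set :: "'a set \<Rightarrow> 'a" where
  "as_set A = (THE a. elts a = A)"

definition Un_of :: "'a \<Rightarrow> 'a" where
  "Un_of c = as_set (\<Union>a\<in>elts c. elts a)"

definition pair :: "'a \<Rightarrow> 'a \<Rightarrow> 'a" where
  "pair x y = as_set {as_set {x}, as_set {x, y}}"

definition function_on :: "'a \<Rightarrow> 'a \<Rightarrow> bool" where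
  "function_on a f \<longleftrightarrow>
    (\<forall>p\<in>elts f. \<exists>x\<in>elts a. \<exists>y. p = pair x y) \<and> (\<forall>x\<in>elts a. \<exists>!y. mem (pair x y) f)"

definition app :: "'a \<Rightarrow> 'a \<Rightarrow> 'a" where
  "app f x = (THE y. mem (pair x y) f)"

definition lam :: "'a \<Rightarrow> ('a \<Rightarrow> 'a) \<Rightarrow> 'a" where
  "lam a F = as_set {pair x (F x) |x. x \<in> elts a}"

definition restrict :: "'a \<Rightarrow> 'a \<Rightarrow> 'a" where
  "restrict f a = lam a (app f)"

definition product :: "'a \<Rightarrow> 'a \<Rightarrow> 'a" where
  "product I X = as_set {f. function_on I f \<and> (\<forall>i\<in>elts I. mem (app f i) (app X i))}"

definition choice :: bool where
  "choice \<longleftrightarrow> (\<forall>I X. function_on I X \<and> (\<forall>i\<in>elts I. elts (app X i) \<noteq> {})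
    \<longrightarrow> elts (product I X) \<noteq> {})"

text \<open>
  The natural numbers of the structure are the members of all its inductive sets. They and the
  enumerations witnessing finiteness may differ from those of HOL.
\<close>

definition is_inductive :: "'a \<Rightarrow> bool" where
  "is_inductive w \<longleftrightarrow> mem (as_set {}) w \<and> (\<forall>x\<in>elts w. mem (as_set (insert x (elts x))) w)"

definition natural :: "'a \<Rightarrow> bool" where
  "natural n \<longleftrightarrow> (\<forall>w. is_inductive w \<longrightarrow> mem n w)"

definition finite_set :: "'a \<Rightarrow> bool" where
  "finite_set a \<longleftrightarrow>
    (\<exists>n f. natural n \<and> function_on n f \<and> bij_betw (app f) (elts n) (elts a))"

subsection \<open>Topology\<close>

definition topology :: "'a \<Rightarrow> 'a \<Rightarrow> bool" where
  "topology X T \<longleftrightarrow>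
    (\<forall>U\<in>elts T. elts U \<subseteq> elts X) \<and> mem (as_set {}) T \<and> mem X T \<and>
    (\<forall>U\<in>elts T. \<forall>V\<in>elts T. mem (as_set (elts U \<inter> elts V)) T) \<and>
    (\<forall>C. elts C \<subseteq> elts T \<longrightarrow> mem (Un_of C) T)"

definition topology_of_basis :: "'a \<Rightarrow> 'a" where
  "topology_of_basis B = as_set {Un_of C |C. elts C \<subseteq> elts B}"

definition closed_in :: "'a \<Rightarrow> 'a \<Rightarrow> 'a \<Rightarrow> bool" where
  "closed_in X T K \<longleftrightarrow> elts K \<subseteq> elts X \<and> mem (as_set (elts X - elts K)) T"

definition compact :: "'a \<Rightarrow> 'a \<Rightarrow> bool" where
  "compact X T \<longleftrightarrow>
    (\<forall>C. elts C \<subseteq> elts T \<and> elts X \<subseteq> elts (Un_of C)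
      \<longrightarrow> (\<exists>D. elts D \<subseteq> elts C \<and> finite_set D \<and> elts X \<subseteq> elts (Un_of D)))"

definition distinguishable :: "'a \<Rightarrow> 'a \<Rightarrow> 'a \<Rightarrow> bool" where
  "distinguishable T x y \<longleftrightarrow> (\<exists>U\<in>elts T. mem x U \<noteq> mem y U)"

definition preregular :: "'a \<Rightarrow> 'a \<Rightarrow> bool" where
  "preregular X T \<longleftrightarrow>
    (\<forall>x\<in>elts X. \<forall>y\<in>elts X. distinguishable T x y
      \<longrightarrow> (\<exists>U\<in>elts T. \<exists>V\<in>elts T. mem x U \<and> mem y V \<and> elts U \<inter> elts V = {}))"

definition continuous :: "'a \<Rightarrow> 'a \<Rightarrow> 'a \<Rightarrow> 'a \<Rightarrow> 'a \<Rightarrow> bool" where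
  "continuous X T Y R f \<longleftrightarrow>
    function_on X f \<and> (\<forall>x\<in>elts X. mem (app f x) Y) \<and>
    (\<forall>V\<in>elts R. mem (as_set {x \<in> elts X. mem (app f x) V}) T)"

definition hyperspace :: "'a \<Rightarrow> 'a \<Rightarrow> 'a" where
  "hyperspace X T = as_set {K. closed_in X T K \<and> elts K \<noteq> {}}"

definition upper_vietoris :: "'a \<Rightarrow> 'a \<Rightarrow> 'a" where
  "upper_vietoris X T = topology_of_basis
    (as_set {as_set {K \<in> elts (hyperspace X T). elts K \<subseteq> elts U} |U. U \<in> elts T})"

text \<open>
  Basic open sets of the product are boxes of open sets with all but finitely many sides full.
\<close>

definition product_topology :: "'a \<Rightarrow> 'a \<Rightarrow> 'a \<Rightarrow> 'a" where
  "product_topology I X T = topology_of_basis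
    (as_set {product I U |U. function_on I U \<and> (\<forall>i\<in>elts I. mem (app U i) (app T i)) \<and>
      finite_set (as_set {i \<in> elts I. app U i \<noteq> app X i})})"

subsection \<open>Games\<close>

definition remove :: "'a \<Rightarrow> 'a \<Rightarrow> 'a" where
  "remove I i = as_set (elts I - {i})"

definition two_elements :: "'a \<Rightarrow> bool" where
  "two_elements I \<longleftrightarrow> (\<exists>i\<in>elts I. \<exists>j\<in>elts I. i \<noteq> j)"

definition is_game :: "'a game \<Rightarrow> bool" where
  "is_game G \<longleftrightarrow>
    two_elements (players G) \<and>
    function_on (players G) (strategies G) \<and>
    function_on (players G) (opens G) \<and>
    function_on (players G) (best_response G) \<and>
    (\<forall>i\<in>elts (players G).
      elts (app (strategies G) i) \<noteq> {} \<and>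
      topology (app (strategies G) i) (app (opens G) i) \<and>
      continuous
        (product (remove (players G) i) (strategies G))
        (product_topology (remove (players G) i) (strategies G) (opens G))
        (hyperspace (app (strategies G) i) (app (opens G) i))
        (upper_vietoris (app (strategies G) i) (app (opens G) i))
        (app (best_response G) i))"

definition nash_equilibrium :: "'a game \<Rightarrow> 'a \<Rightarrow> bool" where
  "nash_equilibrium G s \<longleftrightarrow>
    mem s (product (players G) (strategies G)) \<and>
    (\<forall>i\<in>elts (players G).
      mem (app s i) (app (app (best_response G) i) (restrict s (remove (players G) i))))"

text \<open>
  In the reduction around \<open>p\<close>, a profile \<open>q\<close> of the other players in \<open>J\<close> is completed by \<open>p\<close> to the
  profile \<open>p \<union> q\<close> of all other players.
\<close>

definition reduction :: "'a game \<Rightarrow> 'a \<Rightarrow> 'a \<Rightarrow> 'a game" where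
  "reduction G J p =
    \<lparr>players = J,
     strategies = restrict (strategies G) J,
     opens = restrict (opens G) J,
     best_response =
       lam J (\<lambda>i. lam (product (remove J i) (strategies G))
         (\<lambda>q. app (app (best_response G) i) (as_set (elts p \<union> elts q))))\<rparr>"

text \<open>
  Nonemptiness of the strategy spaces and continuity of the best responses are part of \<open>is_game\<close>.
\<close>

definition well_specified :: "'a game \<Rightarrow> bool" where
  "well_specified G \<longleftrightarrow>
    is_game G \<and>
    (\<forall>i\<in>elts (players G).
      preregular (app (strategies G) i) (app (opens G) i) \<and>
      compact (app (strategies G) i) (app (opens G) i)) \<and>
    (\<forall>J p. elts J \<subseteq> elts (players G) \<and> two_elements J \<and> finite_set J \<and>
        mem p (product (as_set (elts (players G) - elts J)) (strategies G))
      \<longrightarrow> (\<exists>s. nash_equilibrium (reduction G J p) s))"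

end

end

theory Submission
  imports Defs
begin

text \<open>
  Given a family \<open>X\<close> of nonempty sets, let player \<open>i\<close> have strategy space \<open>X i\<close> with the indiscrete
  topology, and let every strategy be a best response to everything. Indiscrete spaces are compact
  and preregular, and constant correspondences are continuous. A finite reduction has an equilibrium
  because ZF proves choice for finite families, by induction on the natural numbers of the model.
  So the game is well-specified, and an equilibrium of it is a point of the product of \<open>X\<close>.
\<close>

subsection \<open>Definability with parameters\<close>

text \<open>Everything happens inside a model of ZF, so a collection described in HOL counts as a
  set only after separation or replacement has been applied to an object-language formula. Terms
  such as \<open>app\<close>, \<open>lam\<close> and \<open>product\<close> are built from
  \<open>THE\<close> and are not known to be definable, so constructions that need one of the
  schemes are also described by membership alone. Finiteness is that of the model, whose natural
  numbers may be nonstandard; hence induction covers definable properties only. The indiscrete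
  topology exists on any set without choosing further structure. A product of indiscrete spaces is
  indiscrete even if it is empty, so continuity can be checked without knowing whether any profile
  exists, which is the point at issue. Families with fewer than two indices do not form games and
  fall under finite choice.\<close>

primrec rename :: "(nat \<Rightarrow> nat) \<Rightarrow> fm \<Rightarrow> fm" where
  "rename g (Member m n) = Member (g m) (g n)"
| "rename g (Equal m n) = Equal (g m) (g n)"
| "rename g (Neg \<phi>) = Neg (rename g \<phi>)"
| "rename g (Conj \<phi> \<psi>) = Conj (rename g \<phi>) (rename g \<psi>)"
| "rename g (All n \<phi>) = All (g n) (rename g \<phi>)"

text \<open>Bound variables are renamed too; injectivity ensures that updating \<open>g n\<close>
  changes the slot of \<open>n\<close> and no other.\<close>

lemma sat_rename:
  assumes "inj g"
  shows "sat E v (rename g \<phi>) \<longleftrightarrow> sat E (\<lambda>n. v (g n)) \<phi>"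
proof (induction \<phi> arbitrary: v)
  case (All n \<phi>)
  have "(\<lambda>m. (v(g n := x)) (g m)) = (\<lambda>m. v (g m))(n := x)" for x
    using assms by (auto simp: fun_eq_iff inj_eq)
  then show ?case
    using All by simp
qed auto

text \<open>Keeping arguments and parameters in separate infinite streams leaves room to merge the
  parameters of two formulas, and to shift arguments under a quantifier, without collisions.\<close>

definition interleave :: "(nat \<Rightarrow> 'a) \<Rightarrow> (nat \<Rightarrow> 'a) \<Rightarrow> nat \<Rightarrow> 'a" where
  "interleave e w n = (if even n then e (n div 2) else w (n div 2))"

lemma interleave_even [simp]: "interleave e w (2 * n) = e n"
  and interleave_odd [simp]: "interleave e w (Suc (2 * n)) = w n"
  by (simp_all add: interleave_def)

lemma interleave_update: "(interleave e w)(2 * n := x) = interleave (e(n := x)) w"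
proof
  fix k
  show "((interleave e w)(2 * n := x)) k = interleave (e(n := x)) w k"
    by (cases "k = 2 * n") (auto simp: interleave_def)
qed

sublocale ZF \<subseteq> membership mem .

context ZF
begin

text \<open>
  The even variables of the formula are the arguments \<open>e\<close>, the odd ones are parameters. In
  \<open>definable_All\<close> the bound variable becomes argument 0 and the other arguments are shifted, so that
  definability of a concrete predicate is proved by applying introduction rules.
\<close>

definition definable :: "((nat \<Rightarrow> 'a) \<Rightarrow> bool) \<Rightarrow> bool" where
  "definable P \<longleftrightarrow> (\<exists>\<phi> w. \<forall>e. P e \<longleftrightarrow> sat mem (interleave e w) \<phi>)"

definition simple_term :: "((nat \<Rightarrow> 'a) \<Rightarrow> 'a) \<Rightarrow> bool" where
  "simple_term t \<longleftrightarrow> (\<exists>n. t = (\<lambda>e. e n)) \<or> (\<exists>c. t = (\<lambda>e. c))"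

lemma simple_term_variable: "simple_term (\<lambda>e. e n)"
  and simple_term_constant: "simple_term (\<lambda>e. c)"
  by (auto simp: simple_term_def)

lemma simple_term_shift:
  assumes "simple_term t"
  shows "simple_term (\<lambda>e. t (\<lambda>n. e (Suc n)))"
  using assms unfolding simple_term_def by auto

lemma simple_term_interleave:
  assumes "simple_term s" "simple_term t"
  shows "\<exists>m n w. \<forall>e. s e = interleave e w m \<and> t e = interleave e w n"
proof -
  \<comment> \<open>A constant term is evaluated at an arbitrary argument and stored as parameter 0
    or 1, that is, as variable 1 or 3; for a term that is a variable, the stored value is never
    read.\<close>
  define w where "w k = (if k = 0 then s (\<lambda>_. undefined) else t (\<lambda>_. undefined))" for k :: nat
  have "r e = interleave e w (2 * n)" if "r = (\<lambda>e. e n)" for r e n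
    using that by simp
  moreover have "s e = interleave e w 1" if "s = (\<lambda>e. c)" for e c
    using that by (simp add: interleave_def w_def)
  moreover have "t e = interleave e w 3" if "t = (\<lambda>e. c)" for e c
    using that by (simp add: interleave_def w_def)
  ultimately have "\<exists>m. \<forall>e. s e = interleave e w m" "\<exists>n. \<forall>e. t e = interleave e w n"
    using assms unfolding simple_term_def by blast+
  then show ?thesis
    by blast
qed

lemma definable_Member:
  assumes "simple_term s" "simple_term t"
  shows "definable (\<lambda>e. mem (s e) (t e))"
  using simple_term_interleave[OF assms] unfolding definable_def by (metis sat.simps(1))

lemma definable_Equal:
  assumes "simple_term s" "simple_term t"
  shows "definable (\<lambda>e. s e = t e)"
  using simple_term_interleave[OF assms] unfolding definable_def by (metis sat.simps(2))

lemma definable_Not: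
  assumes "definable P"
  shows "definable (\<lambda>e. \<not> P e)"
  using assms unfolding definable_def by (metis sat.simps(3))

lemma definable_conj:
  assumes "definable P" "definable Q"
  shows "definable (\<lambda>e. P e \<and> Q e)"
proof -
  obtain \<phi> w where \<phi>: "\<And>e. P e \<longleftrightarrow> sat mem (interleave e w) \<phi>"
    using assms(1) unfolding definable_def by blast
  obtain \<psi> u where \<psi>: "\<And>e. Q e \<longleftrightarrow> sat mem (interleave e u) \<psi>"
    using assms(2) unfolding definable_def by blast
  \<comment> \<open>The arguments are shared and stay in place. Parameter \<open>k\<close> of
    \<open>\<phi>\<close> moves to parameter \<open>2 * k\<close>, and that of \<open>\<psi>\<close>
    to parameter \<open>2 * k + 1\<close>.\<close>
  define g h :: "nat \<Rightarrow> nat"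
    where "g n = (if even n then n else Suc (2 * (2 * (n div 2))))"
      and "h n = (if even n then n else Suc (2 * Suc (2 * (n div 2))))" for n
  have inj: "inj g" "inj h"
    unfolding inj_def g_def h_def by (auto split: if_splits elim!: evenE oddE; presburger)+
  have "(\<lambda>n. interleave e (interleave w u) (g n)) = interleave e w"
    "(\<lambda>n. interleave e (interleave w u) (h n)) = interleave e u" for e
    by (auto simp: fun_eq_iff g_def h_def interleave_def elim!: oddE)
  then have "P e \<and> Q e \<longleftrightarrow>
      sat mem (interleave e (interleave w u)) (Conj (rename g \<phi>) (rename h \<psi>))" for e
    by (simp add: sat_rename inj \<phi> \<psi>)
  then show ?thesis
    unfolding definable_def by blast
qed

lemma definable_All:
  assumes "definable (\<lambda>e. P (e 0) (\<lambda>n. e (Suc n)))"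
  shows "definable (\<lambda>e. \<forall>x. P x e)"
proof -
  obtain \<phi> w where \<phi>: "\<And>e. P (e 0) (\<lambda>n. e (Suc n)) \<longleftrightarrow> sat mem (interleave e w) \<phi>"
    using assms unfolding definable_def by blast
  \<comment> \<open>Argument 0 becomes the quantified variable 1, the later arguments move down one
    place, and the parameters move up one place to free variable 1.\<close>
  define g :: "nat \<Rightarrow> nat"
    where "g n = (if n = 0 then 1 else if even n then n - 2 else n + 2)" for n
  have "inj g"
    unfolding inj_def g_def by (auto split: if_splits elim!: evenE oddE; presburger)
  define u where "u = case_nat undefined w"
  have "(\<lambda>n. ((interleave e u)(1 := x)) (g n)) = interleave (case_nat x e) w" for e x
  proof
    fix n
    show "((interleave e u)(1 := x)) (g n) = interleave (case_nat x e) w n"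
    proof (cases "even n")
      case True
      then obtain k where "n = 2 * k" by blast
      then show ?thesis
        by (cases k) (auto simp: g_def interleave_def)
    next
      case False
      then obtain k where "n = 2 * k + 1" by (rule oddE)
      then show ?thesis
        by (auto simp: g_def interleave_def u_def)
    qed
  qed
  then have "(\<forall>x. P x e) \<longleftrightarrow> sat mem (interleave e u) (All 1 (rename g \<phi>))" for e
    using \<phi>[of "case_nat _ e"] \<open>inj g\<close> by (simp add: sat_rename)
  then show ?thesis
    unfolding definable_def by blast
qed

lemma definable_imp:
  assumes "definable P" "definable Q"
  shows "definable (\<lambda>e. P e \<longrightarrow> Q e)"
  using definable_Not[OF definable_conj[OF assms(1) definable_Not[OF assms(2)]]] by simp

lemma definable_disj:
  assumes "definable P" "definable Q"
  shows "definable (\<lambda>e. P e \<or> Q e)"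
  using definable_imp[OF definable_Not[OF assms(1)] assms(2)] by (simp add: disj_imp)

lemma definable_iff:
  assumes "definable P" "definable Q"
  shows "definable (\<lambda>e. P e \<longleftrightarrow> Q e)"
  using definable_conj[OF definable_imp[OF assms] definable_imp[OF assms(2,1)]]
  by (simp add: iff_conv_conj_imp)

lemma definable_Ex:
  assumes "definable (\<lambda>e. P (e 0) (\<lambda>n. e (Suc n)))"
  shows "definable (\<lambda>e. \<exists>x. P x e)"
  using definable_Not[OF definable_All[of "\<lambda>x e. \<not> P x e", OF definable_Not[OF assms]]] by simp

lemmas definable_intros =
  definable_Member definable_Equal definable_Not definable_conj definable_disj definable_imp
  definable_iff definable_All definable_Ex
  simple_term_variable simple_term_constant

subsection \<open>Sets and functions of the model\<close>

lemma in_elts [simp]: "x \<in> elts a \<longleftrightarrow> mem x a"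
  by (simp add: elts_def)

lemma Ball_elts [simp]: "(\<forall>x\<in>elts a. P x) \<longleftrightarrow> (\<forall>x. mem x a \<longrightarrow> P x)"
  and Bex_elts [simp]: "(\<exists>x\<in>elts a. P x) \<longleftrightarrow> (\<exists>x. mem x a \<and> P x)"
  by auto

lemma elts_subset_elts [simp]: "elts a \<subseteq> elts b \<longleftrightarrow> (\<forall>x. mem x a \<longrightarrow> mem x b)"
  by (simp add: subset_iff)

lemma elts_inject [simp]: "elts a = elts b \<longleftrightarrow> a = b"
  using extensionality[of a b] by (auto simp: set_eq_iff)

section \<open>Collections that are sets of the model\<close>

definition is_set :: "'a set \<Rightarrow> bool" where
  "is_set A \<longleftrightarrow> (\<exists>a. elts a = A)"

lemma elts_eqI:
  assumes "\<And>x. mem x a \<longleftrightarrow> x \<in> A"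
  shows "elts a = A"
  by (rule set_eqI) (simp add: assms)

lemma is_setI:
  assumes "\<And>x. mem x a \<longleftrightarrow> x \<in> A"
  shows "is_set A"
  using elts_eqI[OF assms] unfolding is_set_def by blast

lemma as_set_elts [simp]: "as_set (elts a) = a"
  unfolding as_set_def by simp

lemma elts_as_set:
  assumes "is_set A"
  shows "elts (as_set A) = A"
  using assms unfolding is_set_def by auto

lemma mem_as_set:
  assumes "is_set A"
  shows "mem x (as_set A) \<longleftrightarrow> x \<in> A"
  using elts_as_set[OF assms] in_elts by metis

lemma is_set_elts [simp]: "is_set (elts a)"
  by (auto simp: is_set_def)

lemma as_set_inject:
  assumes "is_set A" "is_set B"
  shows "as_set A = as_set B \<longleftrightarrow> A = B"
  using assms elts_as_set by metis

text \<open>Argument 0 is variable 0 of the interleaved valuation, exactly the variable that the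
  separation scheme updates.\<close>

lemma is_set_Collect_conj:
  assumes "definable (\<lambda>e. P (e 0))"
  shows "is_set {x. mem x a \<and> P x}"
proof -
  obtain \<phi> w where \<phi>: "\<And>e. P (e 0) \<longleftrightarrow> sat mem (interleave e w) \<phi>"
    using assms unfolding definable_def by blast
  have "(interleave e w)(0 := x) = interleave (e(0 := x)) w" for e x
    using interleave_update[of e w 0 x] by simp
  then have "sat mem ((interleave (\<lambda>_. undefined) w)(0 := x)) \<phi> \<longleftrightarrow> P x" for x
    using \<phi>[of "(\<lambda>_. undefined)(0 := x)"] by simp
  moreover obtain b where "\<forall>x. mem x b \<longleftrightarrow>
      mem x a \<and> sat mem ((interleave (\<lambda>_. undefined) w)(0 := x)) \<phi>"
    using separation by blast
  ultimately show ?thesis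
    by (intro is_setI[of b]) simp
qed

lemma is_set_replacement:
  assumes "definable (\<lambda>e. R (e 0) (e 1))"
    and "\<And>x y z. mem x a \<Longrightarrow> R x y \<Longrightarrow> R x z \<Longrightarrow> y = z"
  shows "is_set {y. \<exists>x. mem x a \<and> R x y}"
proof -
  obtain \<phi> w where \<phi>: "\<And>e. R (e 0) (e 1) \<longleftrightarrow> sat mem (interleave e w) \<phi>"
    using assms(1) unfolding definable_def by blast
  \<comment> \<open>The scheme reads the value from variable 1, whereas argument 1 sits at variable
    2; \<open>g\<close> swaps the two and is its own inverse.\<close>
  define g :: "nat \<Rightarrow> nat" where "g = (\<lambda>n. n)(1 := 2, 2 := 1)"
  have "inj g"
    unfolding inj_def g_def by simp
  define v where "v = (\<lambda>n. interleave (\<lambda>_. undefined) w (g n))"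
  have "(\<lambda>n. (v(0 := x, 1 := y)) (g n)) =
      interleave ((\<lambda>_. undefined)(0 := x, 1 := y)) w" for x y
  proof -
    have "(\<lambda>n. (v(0 := x, 1 := y)) (g n)) = (interleave (\<lambda>_. undefined) w)(0 := x, 2 := y)"
      by (auto simp: fun_eq_iff v_def g_def)
    then show ?thesis
      using interleave_update[of _ w 0 x] interleave_update[of _ w 1 y] by simp
  qed
  then have sat: "sat mem (v(0 := x, 1 := y)) (rename g \<phi>) \<longleftrightarrow> R x y" for x y
    using \<phi>[of "(\<lambda>_. undefined)(0 := x, 1 := y)"] \<open>inj g\<close> by (simp add: sat_rename)
  obtain b where "\<forall>y. mem y b \<longleftrightarrow> (\<exists>x. mem x a \<and> sat mem (v(0 := x, 1 := y)) (rename g \<phi>))"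
    using replacement[of a v "rename g \<phi>"] assms(2) unfolding sat by blast
  then show ?thesis
    by (intro is_setI[of b]) (simp only: sat mem_Collect_eq)
qed

lemma is_set_Pow: "is_set {x. elts x \<subseteq> elts a}"
proof -
  obtain b where "\<forall>x. mem x b \<longleftrightarrow> (\<forall>y. mem y x \<longrightarrow> mem y a)"
    using power_set by blast
  then show ?thesis
    by (intro is_setI[of b]) auto
qed

lemma is_set_Union: "is_set (\<Union>x\<in>elts a. elts x)"
proof -
  obtain b where "\<forall>x. mem x b \<longleftrightarrow> (\<exists>y. mem y a \<and> mem x y)"
    using union by blast
  then show ?thesis
    by (intro is_setI[of b]) auto
qed

lemma is_set_Un:
  assumes "is_set A" "is_set B"
  shows "is_set (A \<union> B)"
proof -
  obtain a b where [simp]: "A = elts a" "B = elts b"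
    using assms unfolding is_set_def by blast
  obtain c where "\<forall>x. mem x c \<longleftrightarrow> x = a \<or> x = b"
    using pairing by blast
  then have "elts c = {a, b}"
    by (intro elts_eqI) simp
  then show ?thesis
    using is_set_Union[of c] by simp
qed

lemma is_set_Diff:
  assumes "is_set A" "is_set B"
  shows "is_set (A - B)"
proof -
  obtain a b where [simp]: "A = elts a" "B = elts b"
    using assms unfolding is_set_def by blast
  have "is_set {x. mem x a \<and> \<not> mem x b}"
    by (rule is_set_Collect_conj) (intro definable_intros)
  moreover have "{x. mem x a \<and> \<not> mem x b} = A - B"
    by auto
  ultimately show ?thesis
    by simp
qed

lemma is_set_empty [simp]: "is_set {}"
proof -
  obtain e where "\<forall>x. \<not> mem x e"
    using infinity by blast
  then show ?thesis
    by (intro is_setI[of e]) auto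
qed

lemma is_set_insert:
  assumes "is_set A"
  shows "is_set (insert x A)"
proof -
  have "is_set {x}"
  proof -
    obtain c where "\<forall>z. mem z c \<longleftrightarrow> z = x \<or> z = x"
      using pairing by blast
    then show ?thesis
      by (intro is_setI[of c]) auto
  qed
  then show ?thesis
    using is_set_Un[of "{x}"] assms by simp
qed

lemma is_set_finite:
  assumes "finite A"
  shows "is_set A"
  using assms by (induction A) (auto intro: is_set_insert)

lemma mem_as_set_finite [simp]: "finite A \<Longrightarrow> mem x (as_set A) \<longleftrightarrow> x \<in> A"
  by (simp add: mem_as_set is_set_finite)

lemma elts_as_set_finite [simp]: "finite A \<Longrightarrow> elts (as_set A) = A"
  by (simp add: elts_as_set is_set_finite)

lemma as_set_finite_inject [simp]:
  assumes "finite A" "finite B"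
  shows "as_set A = as_set B \<longleftrightarrow> A = B"
  using assms by (simp add: as_set_inject is_set_finite)

section \<open>Ordered pairs and functions\<close>

lemma pair_inject [simp]: "pair x y = pair x' y' \<longleftrightarrow> x = x' \<and> y = y'"
  by (auto simp: pair_def doubleton_eq_iff)

text \<open>Unfolds the Kuratowski pair into bare membership and equality, which makes it
  definable.\<close>

lemma eq_pair_iff:
  "p = pair x y \<longleftrightarrow>
    (\<forall>z. mem z p \<longleftrightarrow> (\<forall>u. mem u z \<longleftrightarrow> u = x) \<or> (\<forall>u. mem u z \<longleftrightarrow> u = x \<or> u = y))"
proof -
  have eq: "z = as_set A \<longleftrightarrow> (\<forall>u. mem u z \<longleftrightarrow> u \<in> A)" if "finite A" for z A
    using extensionality[of z "as_set A"] that by auto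
  have "p = pair x y \<longleftrightarrow> (\<forall>z. mem z p \<longleftrightarrow> z = as_set {x} \<or> z = as_set {x, y})"
    unfolding pair_def by (subst eq) simp_all
  also have "\<dots> \<longleftrightarrow> (\<forall>z. mem z p \<longleftrightarrow> (\<forall>u. mem u z \<longleftrightarrow> u \<in> {x}) \<or> (\<forall>u. mem u z \<longleftrightarrow> u \<in> {x, y}))"
    by (subst (1 2) eq) (rule finite.intros | rule refl)+
  finally show ?thesis
    by simp
qed

lemma definable_eq_pair:
  assumes "simple_term p" "simple_term s" "simple_term t"
  shows "definable (\<lambda>e. p e = pair (s e) (t e))"
  unfolding eq_pair_iff by (intro definable_intros simple_term_shift assms)

lemma definable_mem_pair:
  assumes "simple_term f" "simple_term s" "simple_term t"
  shows "definable (\<lambda>e. mem (pair (s e) (t e)) (f e))"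
proof -
  have "definable (\<lambda>e. \<exists>p. p = pair (s e) (t e) \<and> mem p (f e))"
    by (intro definable_eq_pair definable_intros simple_term_shift assms)
  then show ?thesis
    by simp
qed

lemma definable_function_on:
  assumes "simple_term a" "simple_term f"
  shows "definable (\<lambda>e. function_on (a e) (f e))"
  unfolding function_on_def Ball_def Bex_def Ex1_def in_elts
  by (intro definable_eq_pair definable_mem_pair definable_intros simple_term_shift assms)

text \<open>Links \<open>app\<close> to membership of a pair: the former is a description, the
  latter is definable.\<close>

lemma mem_pair_iff:
  assumes "function_on a f"
  shows "mem (pair x y) f \<longleftrightarrow> mem x a \<and> y = app f x"
proof -
  have "\<exists>!y. mem (pair x y) f" if "mem x a"
    using assms that unfolding function_on_def by simp
  then have "mem (pair x y) f \<longleftrightarrow> y = app f x" if "mem x a"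
    unfolding app_def using that by (metis theI')
  moreover have "mem x a" if xy: "mem (pair x y) f"
  proof -
    have "\<forall>p. mem p f \<longrightarrow> (\<exists>x. mem x a \<and> (\<exists>y. p = pair x y))"
      using assms by (simp add: function_on_def)
    from this[rule_format, OF xy] show ?thesis
      by simp
  qed
  ultimately show ?thesis
    by blast
qed

lemma function_onI:
  assumes "\<And>p. mem p f \<longleftrightarrow> (\<exists>x. mem x a \<and> p = pair x (F x))"
  shows "function_on a f" and "\<And>x. mem x a \<Longrightarrow> app f x = F x"
  using assms unfolding function_on_def app_def by auto

lemma function_on_mem:
  assumes "function_on a f"
  shows "mem p f \<longleftrightarrow> (\<exists>x. mem x a \<and> p = pair x (app f x))"
  using assms mem_pair_iff[OF assms] unfolding function_on_def by (metis in_elts)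

text \<open>\<open>F\<close> is an arbitrary HOL function, so replacement needs a definable relation
  \<open>R\<close> that agrees with its graph on \<open>a\<close>. The value comes first among the
  arguments because in the proof it is bound by an existential quantifier, which occupies argument
  0.\<close>

lemma
  assumes "definable (\<lambda>e. R (e 1) (e 0))"
    and "\<And>x y. mem x a \<Longrightarrow> R x y \<longleftrightarrow> y = F x"
  shows function_on_lam: "function_on a (lam a F)"
    and app_lam: "mem x a \<Longrightarrow> app (lam a F) x = F x"
proof -
  have "definable (\<lambda>e. \<exists>y. R (e 0) y \<and> e 1 = pair (e 0) y)"
    using assms(1) by (intro definable_eq_pair definable_intros) simp
  then have "is_set {p. \<exists>x. mem x a \<and> (\<exists>y. R x y \<and> p = pair x y)}"
    using assms(2) by (intro is_set_replacement) auto
  moreover have "{p. \<exists>x. mem x a \<and> (\<exists>y. R x y \<and> p = pair x y)} = {pair x (F x) |x. x \<in> elts a}"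
    using assms(2) by auto
  ultimately have "mem p (lam a F) \<longleftrightarrow> (\<exists>x. mem x a \<and> p = pair x (F x))" for p
    unfolding lam_def by (simp add: mem_as_set) blast
  from function_onI[OF this]
  show "function_on a (lam a F)" and "mem x a \<Longrightarrow> app (lam a F) x = F x"
    by auto
qed

lemma lam_cong:
  assumes "\<And>x. mem x a \<Longrightarrow> F x = H x"
  shows "lam a F = lam a H"
proof -
  have "{pair x (F x) |x. x \<in> elts a} = {pair x (H x) |x. x \<in> elts a}"
    using assms by auto
  then show ?thesis
    by (simp add: lam_def)
qed

lemma function_on_lam_const: "function_on a (lam a (\<lambda>_. c))"
  and app_lam_const: "mem x a \<Longrightarrow> app (lam a (\<lambda>_. c)) x = c"
proof -
  have *: "definable (\<lambda>e. e 0 = c)"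
    by (intro definable_intros)
  show "function_on a (lam a (\<lambda>_. c))"
    by (rule function_on_lam[of "\<lambda>_ y. y = c", OF *]) (rule refl)
  show "app (lam a (\<lambda>_. c)) x = c" if "mem x a"
    by (rule app_lam[of "\<lambda>_ y. y = c", OF * _ that]) (rule refl)
qed

lemma
  assumes "function_on I f" "elts J \<subseteq> elts I"
  shows function_on_restrict: "function_on J (restrict f J)"
    and app_restrict: "mem x J \<Longrightarrow> app (restrict f J) x = app f x"
proof -
  have *: "definable (\<lambda>e. mem (pair (e 1) (e 0)) f)"
    by (intro definable_mem_pair definable_intros)
  have **: "mem x J \<Longrightarrow> mem (pair x y) f \<longleftrightarrow> y = app f x" for x y
    using assms(2) by (simp add: mem_pair_iff[OF assms(1)])
  show "function_on J (restrict f J)"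
    unfolding restrict_def
    by (rule function_on_lam[of "\<lambda>x y. mem (pair x y) f", OF * **])
  show "app (restrict f J) x = app f x" if "mem x J"
    unfolding restrict_def
    by (rule app_lam[of "\<lambda>x y. mem (pair x y) f", OF * ** that])
qed

lemma mem_remove [simp]: "mem x (remove I i) \<longleftrightarrow> mem x I \<and> x \<noteq> i"
  unfolding remove_def by (simp add: mem_as_set is_set_Diff is_set_finite)

section \<open>Products and choice functions\<close>

lemma product_cong:
  assumes "\<And>i. mem i I \<Longrightarrow> app X i = app Y i"
  shows "product I X = product I Y"
  using assms unfolding product_def by (simp cong: conj_cong)

text \<open>
  Phrased without \<open>app\<close>, whose value on an arbitrary element \<open>f\<close> is an underspecified \<open>THE\<close> and hence
  not known to be definable.
\<close>

definition choice_function :: "'a \<Rightarrow> 'a \<Rightarrow> 'a \<Rightarrow> bool" where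
  "choice_function J X f \<longleftrightarrow>
    function_on J f \<and> (\<forall>i y c. mem i J \<and> mem (pair i y) f \<and> mem (pair i c) X \<longrightarrow> mem y c)"

lemma definable_choice_function:
  assumes "simple_term J" "simple_term X" "simple_term f"
  shows "definable (\<lambda>e. choice_function (J e) (X e) (f e))"
  unfolding choice_function_def
  by (intro definable_mem_pair definable_function_on definable_intros simple_term_shift assms)

lemma choice_function_iff:
  assumes "function_on I X" "elts J \<subseteq> elts I"
  shows "choice_function J X f \<longleftrightarrow>
    function_on J f \<and> (\<forall>i. mem i J \<longrightarrow> mem (app f i) (app X i))"
proof (cases "function_on J f")
  case True
  then show ?thesis
    using assms(2) unfolding choice_function_def
    by (auto simp: mem_pair_iff[OF True] mem_pair_iff[OF assms(1)])
qed (simp add: choice_function_def)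

lemma mem_Un_of: "mem x (Un_of a) \<longleftrightarrow> (\<exists>y. mem y a \<and> mem x y)"
  unfolding Un_of_def by (simp add: mem_as_set is_set_Union)

lemma mem_product:
  assumes "function_on I X" "elts J \<subseteq> elts I"
  shows "mem f (product J X) \<longleftrightarrow>
    function_on J f \<and> (\<forall>i. mem i J \<longrightarrow> mem (app f i) (app X i))"
proof -
  \<comment> \<open>One union reaches the members of the pairs in \<open>X\<close>, the second
    reaches the sets \<open>app X i\<close>, the third reaches their members.\<close>
  let ?U = "Un_of (Un_of (Un_of X))"
  define W where "W = as_set (elts J \<union> elts ?U)"
  have W: "elts W = elts J \<union> elts ?U"
    unfolding W_def by (intro elts_as_set is_set_Un is_set_elts)
  \<comment> \<open>A pair of members of \<open>W\<close> lies in \<open>Pow (Pow W)\<close>, so a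
    function made of such pairs lies in the next power set, from which separation cuts out the
    product.\<close>
  define Pow where "Pow a = as_set {x. elts x \<subseteq> elts a}" for a
  have Pow: "mem x (Pow a) \<longleftrightarrow> elts x \<subseteq> elts a" for x a
    unfolding Pow_def by (simp only: mem_as_set is_set_Pow mem_Collect_eq)
  have "mem f (Pow (Pow (Pow W)))" if "choice_function J X f" for f
  proof -
    have f: "function_on J f" "\<And>i. mem i J \<Longrightarrow> mem (app f i) (app X i)"
      using that by (auto simp: choice_function_iff[OF assms])
    have "mem p (Pow (Pow W))" if "mem p f" for p
    proof -
      obtain i where i: "mem i J" "p = pair i (app f i)"
        using \<open>mem p f\<close> function_on_mem[OF f(1)] by blast
      have "mem (pair i (app X i)) X"
        using i(1) assms mem_pair_iff[OF assms(1)] by auto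
      moreover have "mem (as_set {i, app X i}) (pair i (app X i))"
        "mem (app X i) (as_set {i, app X i})"
        by (simp_all add: pair_def)
      ultimately have "mem (app f i) ?U"
        unfolding mem_Un_of using f(2)[OF i(1)] by blast
      then show ?thesis
        using i W by (auto simp: Pow pair_def)
    qed
    then show ?thesis
      by (auto simp: Pow)
  qed
  then have "{f. mem f (Pow (Pow (Pow W))) \<and> choice_function J X f} = {f. choice_function J X f}"
    by auto
  moreover have "is_set {f. mem f (Pow (Pow (Pow W))) \<and> choice_function J X f}"
    by (intro is_set_Collect_conj definable_choice_function definable_intros)
  ultimately have "is_set {f. choice_function J X f}"
    by simp
  then show ?thesis
    unfolding product_def by (simp add: choice_function_iff[OF assms] mem_as_set)
qed

subsection \<open>Choice for finite families\<close>

text \<open>Separating the definable property from the set given by infinity yields an inductive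
  set, to which every natural number belongs. For arbitrary HOL predicates this could fail in a
  model with nonstandard numbers.\<close>

lemma natural_induct [consumes 1, case_names definable zero Suc]:
  assumes "natural n"
    and "definable (\<lambda>e. P (e 0))"
    and "P (as_set {})"
    and "\<And>n. P n \<Longrightarrow> P (as_set (insert n (elts n)))"
  shows "P n"
proof -
  obtain w where w: "\<exists>e. mem e w \<and> (\<forall>x. \<not> mem x e)"
    "\<forall>x. mem x w \<longrightarrow> (\<exists>y. mem y w \<and> (\<forall>z. mem z y \<longleftrightarrow> mem z x \<or> z = x))"
    using infinity by blast
  have zero: "mem (as_set {}) w"
  proof -
    obtain e where "mem e w" "\<forall>x. \<not> mem x e"
      using w(1) by blast
    moreover from this have "elts e = {}"
      by (intro elts_eqI) simp
    ultimately show ?thesis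
      using as_set_elts[of e] by simp
  qed
  have Suc: "mem (as_set (insert x (elts x))) w" if "mem x w" for x
  proof -
    obtain y where "mem y w" "\<forall>z. mem z y \<longleftrightarrow> mem z x \<or> z = x"
      using w(2) \<open>mem x w\<close> by blast
    moreover from this have "elts y = insert x (elts x)"
      by (intro elts_eqI) auto
    ultimately show ?thesis
      using as_set_elts[of y] by simp
  qed
  have "is_set {x. mem x w \<and> P x}"
    using assms(2) by (rule is_set_Collect_conj)
  then obtain v where v: "\<And>x. mem x v \<longleftrightarrow> mem x w \<and> P x"
    unfolding is_set_def by (metis in_elts mem_Collect_eq)
  have "is_inductive v"
    unfolding is_inductive_def using zero Suc assms(3,4) by (auto simp: v)
  then show ?thesis
    using assms(1) v unfolding natural_def by blast
qed

lemma function_on_insert: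
  assumes "function_on a f" "\<not> mem x a" "elts b = insert x (elts a)"
    and "elts g = insert (pair x y) (elts f)"
  shows "function_on b g" "app g x = y" "\<And>z. mem z a \<Longrightarrow> app g z = app f z"
proof -
  have a: "mem z b \<longleftrightarrow> z = x \<or> mem z a" for z
    using assms(3) by (auto simp: set_eq_iff)
  have "mem p g \<longleftrightarrow> p = pair x y \<or> mem p f" for p
    using assms(4) by (auto simp: set_eq_iff)
  then have "mem p g \<longleftrightarrow> (\<exists>z. mem z b \<and> p = pair z (if z = x then y else app f z))" for p
    using assms(2) unfolding function_on_mem[OF assms(1)] a by auto
  from function_onI[OF this]
  show "function_on b g" "app g x = y" "\<And>z. mem z a \<Longrightarrow> app g z = app f z"
    using assms(2) by (auto simp: a)
qed

lemma finite_choice: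
  assumes "function_on I X" "elts J \<subseteq> elts I" "finite_set J"
    and nonempty: "\<And>i. mem i J \<Longrightarrow> elts (app X i) \<noteq> {}"
  shows "elts (product J X) \<noteq> {}"
proof -
  obtain N f where N: "natural N" and f: "function_on N f"
    and bij: "bij_betw (app f) (elts N) (elts J)"
    using assms(3) unfolding finite_set_def by blast
  \<comment> \<open>Quantifying over all \<open>K\<close> covered by the first \<open>n\<close>
    values avoids forming images of \<open>f\<close> and makes \<open>remove K ?j\<close> an
    instance of the hypothesis. Only existence of a choice function is asserted, so each step picks
    a single element.\<close>
  define P where "P n \<longleftrightarrow>
    (\<forall>K. (\<forall>j. mem j K \<longrightarrow> mem j J \<and> (\<exists>k. mem k n \<and> mem (pair k j) f)) \<longrightarrow>
      (\<exists>g. choice_function K X g))" for n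
  have "P N"
    using N
  proof (induction rule: natural_induct)
    case definable
    show ?case
      unfolding P_def by (intro definable_mem_pair definable_choice_function definable_intros)
  next
    case zero
    have "choice_function K X (as_set {})" if "\<And>j. \<not> mem j K" for K
      using that by (auto simp: choice_function_def function_on_def)
    then show ?case
      by (auto simp: P_def)
  next
    case (Suc n)
    show ?case
      unfolding P_def
    proof (intro allI impI)
      fix K
      assume "\<forall>j. mem j K \<longrightarrow>
        mem j J \<and> (\<exists>k. mem k (as_set (insert n (elts n))) \<and> mem (pair k j) f)"
      then have K: "mem j J" "(mem n N \<and> j = app f n) \<or> (\<exists>k. mem k n \<and> mem (pair k j) f)"
        if "mem j K" for j
        using that by (auto simp: mem_as_set is_set_insert mem_pair_iff[OF f])
      \<comment> \<open>If \<open>n\<close> is outside \<open>N\<close>, then \<open>app f n\<close>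
        is unspecified; the split remains sound because it asks only whether this element lies in
        \<open>K\<close>.\<close>
      show "\<exists>g. choice_function K X g"
      proof (cases "mem (app f n) K")
        case False
        then show ?thesis
          using K Suc unfolding P_def by blast
      next
        case True
        let ?j = "app f n"
        have "\<forall>j. mem j (remove K ?j) \<longrightarrow> mem j J \<and> (\<exists>k. mem k n \<and> mem (pair k j) f)"
          using K by auto
        then obtain g where "choice_function (remove K ?j) X g"
          using Suc unfolding P_def by blast
        moreover have sub: "elts K \<subseteq> elts I" "elts (remove K ?j) \<subseteq> elts I"
          using K assms(2) by auto
        ultimately have g: "function_on (remove K ?j) g"
          "\<And>i. mem i (remove K ?j) \<Longrightarrow> mem (app g i) (app X i)"
          by (auto simp: choice_function_iff[OF assms(1)])
        obtain y where y: "mem y (app X ?j)"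
          using nonempty[of ?j] K(1)[OF True] by auto
        define h where "h = as_set (insert (pair ?j y) (elts g))"
        have "elts h = insert (pair ?j y) (elts g)"
          unfolding h_def by (intro elts_as_set is_set_insert is_set_elts)
        from function_on_insert[OF g(1) _ _ this, of K] have h: "function_on K h" "app h ?j = y"
          "\<And>i. mem i (remove K ?j) \<Longrightarrow> app h i = app g i"
          using True by (auto simp: set_eq_iff)
        have "mem (app h i) (app X i)" if "mem i K" for i
          using h g(2) y that by (cases "i = ?j") auto
        then show ?thesis
          using h(1) by (auto simp: choice_function_iff[OF assms(1) sub(1)])
      qed
    qed
  qed
  moreover have "\<exists>k. mem k N \<and> mem (pair k j) f" if "mem j J" for j
  proof -
    have "j \<in> app f ` elts N"
      using that bij by (simp add: bij_betw_def)
    then show ?thesis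
      using mem_pair_iff[OF f] by auto
  qed
  ultimately obtain g where "choice_function J X g"
    unfolding P_def by blast
  then show ?thesis
    using choice_function_iff[OF assms(1,2)] mem_product[OF assms(1,2)] by (metis empty_iff in_elts)
qed

lemma finite_set_empty: "finite_set (as_set {})"
  unfolding finite_set_def natural_def is_inductive_def function_on_def
  by (intro exI[of _ "as_set {}"]) (auto simp: bij_betw_def)

lemma finite_set_singleton: "finite_set (as_set {x})"
proof -
  let ?one = "as_set {as_set {}}"
  have "natural ?one"
  proof -
    have "mem ?one w" if "is_inductive w" for w
      using that unfolding is_inductive_def by (metis elts_as_set in_elts is_set_empty)
    then show ?thesis
      by (simp add: natural_def)
  qed
  moreover have "bij_betw (app (lam ?one (\<lambda>_. x))) (elts ?one) (elts (as_set {x}))"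
    by (auto simp: bij_betw_def app_lam_const)
  ultimately show ?thesis
    unfolding finite_set_def using function_on_lam_const by blast
qed

subsection \<open>Indiscrete topologies\<close>

definition indiscrete :: "'a \<Rightarrow> 'a" where
  "indiscrete A = as_set {as_set {}, A}"

lemma elts_indiscrete [simp]: "elts (indiscrete A) = {as_set {}, A}"
  by (simp add: indiscrete_def)

lemma mem_indiscrete [simp]: "mem U (indiscrete A) \<longleftrightarrow> U = as_set {} \<or> U = A"
  by (simp add: indiscrete_def)

lemma Un_of_indiscrete:
  assumes "elts C \<subseteq> {as_set {}, A}"
  shows "Un_of C = (if mem A C then A else as_set {})"
proof -
  have "mem x (Un_of C) \<longleftrightarrow> mem A C \<and> mem x A" for x
    unfolding mem_Un_of using assms by (auto simp: subset_iff)
  then show ?thesis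
    by (auto intro!: extensionality)
qed

lemma topology_indiscrete: "topology A (indiscrete A)"
  unfolding topology_def using Un_of_indiscrete[of _ A] by auto

lemma compact_indiscrete: "compact A (indiscrete A)"
  unfolding compact_def
proof (intro allI impI, elim conjE)
  fix C
  assume C: "elts C \<subseteq> elts (indiscrete A)" "elts A \<subseteq> elts (Un_of C)"
  show "\<exists>D. elts D \<subseteq> elts C \<and> finite_set D \<and> elts A \<subseteq> elts (Un_of D)"
  proof (cases "mem A C")
    case True
    then show ?thesis
      by (intro exI[of _ "as_set {A}"]) (auto simp: finite_set_singleton mem_Un_of)
  next
    case False
    then have "elts A = {}"
      using C Un_of_indiscrete[of C A] by simp
    then show ?thesis
      by (intro exI[of _ "as_set {}"]) (auto simp: finite_set_empty)
  qed
qed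

lemma preregular_indiscrete: "preregular A (indiscrete A)"
  unfolding preregular_def distinguishable_def by auto

text \<open>The only nonempty closed set is the whole space, so the hyperspace is a singleton; this
  also shows that its defining collection is a set.\<close>

lemma mem_hyperspace_indiscrete:
  assumes "elts A \<noteq> {}"
  shows "mem A (hyperspace A (indiscrete A))"
proof -
  have "K = A" if "closed_in A (indiscrete A) K" "elts K \<noteq> {}" for K
  proof -
    have K: "elts K \<subseteq> elts A" "as_set (elts A - elts K) \<in> {as_set {}, as_set (elts A)}"
      using that(1) by (auto simp: closed_in_def)
    then have "elts A - elts K \<in> {{}, elts A}"
      by (simp only: insert_iff empty_iff as_set_inject is_set_Diff is_set_elts is_set_empty)
    then have "elts K = elts A"
      using K(1) that(2) by blast
    then show ?thesis
      by simp
  qed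
  moreover have "closed_in A (indiscrete A) A"
    by (simp add: closed_in_def)
  ultimately have "closed_in A (indiscrete A) K \<and> elts K \<noteq> {} \<longleftrightarrow> K = A" for K
    using assms by metis
  then show ?thesis
    by (simp add: hyperspace_def)
qed

lemma topology_of_basis_indiscrete:
  assumes "elts B \<subseteq> {as_set {}, A}" "mem A B"
  shows "topology_of_basis B = indiscrete A"
proof -
  let ?T = "{Un_of C |C. elts C \<subseteq> elts B}"
  have "Un_of C \<in> {as_set {}, A}" if "elts C \<subseteq> elts B" for C
    using Un_of_indiscrete[of C A] that assms(1) by (simp add: subset_trans)
  then have "?T \<subseteq> {as_set {}, A}"
    by blast
  \<comment> \<open>The empty set is open as the union of the empty family, whether or not it is
    basic.\<close>
  moreover have "as_set {} \<in> ?T"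
    using Un_of_indiscrete[of "as_set {}" "as_set {}"]
    by (intro CollectI exI[of _ "as_set {}"]) simp
  moreover have "A \<in> ?T"
    using Un_of_indiscrete[of B A] assms by (intro CollectI exI[of _ B]) simp
  ultimately have "?T = {as_set {}, A}"
    by (intro equalityI) simp_all
  then show ?thesis
    by (simp add: topology_of_basis_def indiscrete_def)
qed

text \<open>A box of open sides either has all sides full or has an empty side, and in the latter
  case it is empty.\<close>

lemma product_topology_indiscrete:
  assumes "function_on I X" "elts J \<subseteq> elts I"
    and T: "\<And>i. mem i J \<Longrightarrow> app T i = indiscrete (app X i)"
  shows "product_topology J X T = indiscrete (product J X)"
proof -
  let ?B = "{product J U |U. function_on J U \<and> (\<forall>i\<in>elts J. mem (app U i) (app T i)) \<and>
    finite_set (as_set {i \<in> elts J. app U i \<noteq> app X i})}"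
  have sub: "product J U \<in> {as_set {}, product J X}"
    if "\<forall>i\<in>elts J. mem (app U i) (app T i)" for U
  proof (cases "\<forall>i. mem i J \<longrightarrow> app U i = app X i")
    case True
    then show ?thesis
      using product_cong[of J U X] by simp
  next
    case False
    then obtain i where i: "mem i J" "app U i \<noteq> app X i"
      by blast
    then have "app U i = as_set {}"
      using that T[OF i(1)] by auto
    then have "{f. function_on J f \<and> (\<forall>i\<in>elts J. mem (app f i) (app U i))} = {}"
      using i(1) by force
    then have "product J U = as_set {}"
      unfolding product_def by (simp only:)
    then show ?thesis
      by simp
  qed
  \<comment> \<open>The sides must form a function on \<open>J\<close> itself, so the full box is
    given by \<open>restrict X J\<close> rather than by \<open>X\<close>.\<close>
  have "\<exists>U. product J X = product J U \<and> function_on J U \<and>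
    (\<forall>i\<in>elts J. mem (app U i) (app T i)) \<and> finite_set (as_set {i \<in> elts J. app U i \<noteq> app X i})"
  proof (intro exI conjI)
    have app: "\<And>i. mem i J \<Longrightarrow> app (restrict X J) i = app X i"
      using assms(1,2) by (rule app_restrict)
    show "product J X = product J (restrict X J)"
      by (rule product_cong) (simp add: app)
    show "function_on J (restrict X J)"
      using assms(1,2) by (rule function_on_restrict)
    show "\<forall>i\<in>elts J. mem (app (restrict X J) i) (app T i)"
      by (simp add: app T)
    have "{i \<in> elts J. app (restrict X J) i \<noteq> app X i} = {}"
      using app by auto
    then show "finite_set (as_set {i \<in> elts J. app (restrict X J) i \<noteq> app X i})"
      by (simp only: finite_set_empty)
  qed
  then have mem: "product J X \<in> ?B"
    by blast
  \<comment> \<open>At most two boxes occur, so their collection is finite and therefore a set, with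
    no definability argument.\<close>
  have "?B \<subseteq> {as_set {}, product J X}"
    using sub by blast
  moreover from this have "finite ?B"
    by (rule finite_subset) simp
  ultimately have "elts (as_set ?B) \<subseteq> {as_set {}, product J X}" "mem (product J X) (as_set ?B)"
    using mem by (simp_all only: elts_as_set_finite mem_as_set_finite)
  then show ?thesis
    unfolding product_topology_def by (rule topology_of_basis_indiscrete)
qed

text \<open>A preimage under a constant map is empty or the whole space. \<open>R\<close> will be
  the upper Vietoris topology.\<close>

lemma continuous_indiscrete_const:
  assumes "mem c Y"
  shows "continuous A (indiscrete A) Y R (lam A (\<lambda>_. c))"
proof -
  have "{x \<in> elts A. mem (app (lam A (\<lambda>_. c)) x) V} = (if mem c V then elts A else {})" for V
    by (auto simp: app_lam_const)
  then show ?thesis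
    unfolding continuous_def using assms by (simp add: function_on_lam_const app_lam_const)
qed

subsection \<open>The indiscrete game\<close>

lemma mem_lam_const: "mem p (lam a (\<lambda>_. c)) \<longleftrightarrow> (\<exists>x. mem x a \<and> p = pair x c)"
  using function_on_mem[OF function_on_lam_const] by (auto simp: app_lam_const)

text \<open>The index set \<open>J\<close> is a parameter so that the same term describes the full
  game and its reductions.\<close>

definition constant_responses :: "'a \<Rightarrow> 'a \<Rightarrow> 'a" where
  "constant_responses J X = lam J (\<lambda>i. lam (product (remove J i) X) (\<lambda>_. app X i))"

lemma
  assumes "function_on I X" "elts J \<subseteq> elts I"
  shows function_on_constant_responses: "function_on J (constant_responses J X)"
    and app_constant_responses: "mem i J \<Longrightarrow>
      app (constant_responses J X) i = lam (product (remove J i) X) (\<lambda>_. app X i)"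
proof -
  \<comment> \<open>The graph in membership form: \<open>c\<close> is the value of \<open>X\<close>
    at \<open>i\<close>, \<open>r\<close> is \<open>J\<close> without \<open>i\<close>,
    \<open>q\<close> runs through the product over \<open>r\<close>, and \<open>y\<close> consists
    of the pairs of \<open>q\<close> with \<open>c\<close>.\<close>
  define R where "R i y \<longleftrightarrow> (\<exists>c. mem (pair i c) X \<and> (\<forall>p. mem p y \<longleftrightarrow>
    (\<exists>q. (\<exists>r. (\<forall>z. mem z r \<longleftrightarrow> mem z J \<and> \<not> z = i) \<and> choice_function r X q) \<and> p = pair q c)))"
    for i y
  have definable: "definable (\<lambda>e. R (e 1) (e 0))"
    unfolding R_def
    by (intro definable_eq_pair definable_mem_pair definable_choice_function definable_intros)
  have R: "R i y \<longleftrightarrow> y = lam (product (remove J i) X) (\<lambda>_. app X i)" if "mem i J" for i y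
  proof -
    have "(\<forall>z. mem z r \<longleftrightarrow> mem z J \<and> \<not> z = i) \<longleftrightarrow> r = remove J i" for r
      using extensionality[of r "remove J i"] by auto
    moreover have "elts (remove J i) \<subseteq> elts I"
      using assms(2) by auto
    then have "choice_function (remove J i) X q \<longleftrightarrow> mem q (product (remove J i) X)" for q
      using choice_function_iff[OF assms(1)] mem_product[OF assms(1)] by simp
    moreover have "mem (pair i c) X \<longleftrightarrow> c = app X i" for c
      using assms that mem_pair_iff[OF assms(1)] by auto
    ultimately have "R i y \<longleftrightarrow>
        (\<forall>p. mem p y \<longleftrightarrow> mem p (lam (product (remove J i) X) (\<lambda>_. app X i)))"
      unfolding R_def mem_lam_const by simp
    then show ?thesis
      using extensionality by blast
  qed
  show "function_on J (constant_responses J X)"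
    unfolding constant_responses_def by (rule function_on_lam[of R, OF definable R])
  show "app (constant_responses J X) i = lam (product (remove J i) X) (\<lambda>_. app X i)" if "mem i J"
    unfolding constant_responses_def by (rule app_lam[of R, OF definable R that])
qed

lemma
  assumes "function_on I X"
  shows function_on_lam_indiscrete: "function_on I (lam I (\<lambda>i. indiscrete (app X i)))"
    and app_lam_indiscrete: "mem i I \<Longrightarrow>
      app (lam I (\<lambda>i. indiscrete (app X i))) i = indiscrete (app X i)"
proof -
  define R where
    "R i y \<longleftrightarrow> (\<exists>c. mem (pair i c) X \<and> (\<forall>z. mem z y \<longleftrightarrow> z = as_set {} \<or> z = c))" for i y
  have definable: "definable (\<lambda>e. R (e 1) (e 0))"
    unfolding R_def by (intro definable_mem_pair definable_intros)
  have R: "R i y \<longleftrightarrow> y = indiscrete (app X i)" if "mem i I" for i y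
  proof -
    have "R i y \<longleftrightarrow> (\<forall>z. mem z y \<longleftrightarrow> mem z (indiscrete (app X i)))"
      using that by (simp add: R_def mem_pair_iff[OF assms])
    then show ?thesis
      using extensionality by blast
  qed
  show "function_on I (lam I (\<lambda>i. indiscrete (app X i)))"
    by (rule function_on_lam[of R, OF definable R])
  show "app (lam I (\<lambda>i. indiscrete (app X i))) i = indiscrete (app X i)" if "mem i I"
    by (rule app_lam[of R, OF definable R that])
qed

lemma restrict_mem_product:
  assumes "function_on I X" "elts J \<subseteq> elts I" "elts K \<subseteq> elts J" "mem s (product J X)"
  shows "mem (restrict s K) (product K X)"
proof -
  have "elts K \<subseteq> elts I"
    using assms(2,3) by blast
  moreover have s: "function_on J s" "\<And>i. mem i J \<Longrightarrow> mem (app s i) (app X i)"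
    using assms(4) mem_product[OF assms(1,2)] by auto
  ultimately show ?thesis
    using assms(3) mem_product[OF assms(1)] function_on_restrict[OF s(1) assms(3)]
      app_restrict[OF s(1) assms(3)]
    by (simp add: subset_iff)
qed

text \<open>Disjointness of \<open>K\<close> and \<open>L\<close> makes the union of the two
  functions single-valued.\<close>

lemma Un_mem_product:
  assumes "function_on I X" "elts M \<subseteq> elts I"
    and "elts M = elts K \<union> elts L" "elts K \<inter> elts L = {}"
    and "mem p (product K X)" "mem q (product L X)"
  shows "mem (as_set (elts p \<union> elts q)) (product M X)"
proof -
  have "elts K \<subseteq> elts I" "elts L \<subseteq> elts I"
    using assms(2,3) by auto
  then have p: "function_on K p" "\<And>i. mem i K \<Longrightarrow> mem (app p i) (app X i)"
    and q: "function_on L q" "\<And>i. mem i L \<Longrightarrow> mem (app q i) (app X i)"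
    using assms(5,6) mem_product[OF assms(1)] by auto
  have M: "mem i M \<longleftrightarrow> mem i K \<or> mem i L" for i
    using assms(3) in_elts by blast
  have disjoint: "\<not> (mem i K \<and> mem i L)" for i
    using assms(4) in_elts by blast
  have "mem r (as_set (elts p \<union> elts q)) \<longleftrightarrow> mem r p \<or> mem r q" for r
    by (simp add: mem_as_set is_set_Un)
  moreover define F where "F i = (if mem i K then app p i else app q i)" for i
  have F: "\<And>i. mem i K \<Longrightarrow> F i = app p i" "\<And>i. mem i L \<Longrightarrow> F i = app q i"
    using disjoint by (auto simp: F_def)
  ultimately have "mem r (as_set (elts p \<union> elts q)) \<longleftrightarrow> (\<exists>i. mem i M \<and> r = pair i (F i))" for r
    by (simp add: function_on_mem[OF p(1)] function_on_mem[OF q(1)] M F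
        conj_disj_distribR ex_disj_distrib cong: conj_cong)
  from function_onI[OF this] show ?thesis
    unfolding mem_product[OF assms(1,2)] using p(2) q(2) M F by auto
qed

text \<open>Each best-response set is all of \<open>app X i\<close>, so every profile is an
  equilibrium. Only the products are compared because a reduction has strategies
  \<open>restrict X J\<close>, which may differ from \<open>X\<close>.\<close>

lemma nash_equilibrium_constant_responses:
  assumes "function_on I X" "elts J \<subseteq> elts I" "mem s (product J X)"
    and "players G = J" "product J (strategies G) = product J X"
    and "best_response G = constant_responses J X"
  shows "nash_equilibrium G s"
  unfolding nash_equilibrium_def assms(4-6)
proof (intro conjI ballI)
  show "mem s (product J X)"
    by fact
next
  fix i assume "i \<in> elts J"
  then have i: "mem i J"
    by simp
  have "mem (restrict s (remove J i)) (product (remove J i) X)"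
    by (rule restrict_mem_product[OF assms(1,2) _ assms(3)]) auto
  then have "app (app (constant_responses J X) i) (restrict s (remove J i)) = app X i"
    unfolding app_constant_responses[OF assms(1,2) i] by (rule app_lam_const)
  then show "mem (app s i) (app (app (constant_responses J X) i) (restrict s (remove J i)))"
    using i assms(3) mem_product[OF assms(1,2)] by simp
qed

definition indiscrete_game :: "'a \<Rightarrow> 'a \<Rightarrow> 'a game" where
  "indiscrete_game I X =
    \<lparr>players = I, strategies = X, opens = lam I (\<lambda>i. indiscrete (app X i)),
     best_response = constant_responses I X\<rparr>"

lemma reduction_indiscrete_game:
  assumes "function_on I X" "elts J \<subseteq> elts I"
    and p: "mem p (product (as_set (elts I - elts J)) X)"
  shows "best_response (reduction (indiscrete_game I X) J p) = constant_responses J X"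
proof -
  have "app (app (constant_responses I X) i) (as_set (elts p \<union> elts q)) = app X i"
    if i: "mem i J" and q: "mem q (product (remove J i) X)" for i q
  proof -
    have I: "mem i I"
      using i assms(2) by auto
    have diff: "elts (as_set (elts I - elts J)) = elts I - elts J"
      by (intro elts_as_set is_set_Diff is_set_elts)
    have remove: "elts (remove K i) = elts K - {i}" for K
      by (rule elts_eqI) simp
    \<comment> \<open>\<open>I\<close> without \<open>i\<close> is the disjoint union of
      \<open>I\<close> minus \<open>J\<close> and \<open>J\<close> without \<open>i\<close>. The
      completed profile must lie in the domain of the constant map, since \<open>app\<close> is
      unspecified elsewhere.\<close>
    have "mem (as_set (elts p \<union> elts q)) (product (remove I i) X)"
      by (rule Un_mem_product[OF assms(1) _ _ _ p q]) (use assms(2) i in \<open>auto simp: diff remove\<close>)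
    then show ?thesis
      unfolding app_constant_responses[OF assms(1) subset_refl I] by (rule app_lam_const)
  qed
  then show ?thesis
    by (auto simp: reduction_def indiscrete_game_def constant_responses_def[of J] intro!: lam_cong)
qed

text \<open>The point \<open>p\<close> outside \<open>J\<close> is given with the reduction, so an
  equilibrium requires choosing only over the finite set \<open>J\<close>.\<close>

lemma well_specified_indiscrete_game:
  assumes "function_on I X" "two_elements I" and nonempty: "\<And>i. mem i I \<Longrightarrow> elts (app X i) \<noteq> {}"
  shows "well_specified (indiscrete_game I X)"
proof -
  let ?T = "lam I (\<lambda>i. indiscrete (app X i))"
  note T = app_lam_indiscrete[OF assms(1)]
  have "continuous (product (remove I i) X) (product_topology (remove I i) X ?T)
      (hyperspace (app X i) (indiscrete (app X i))) (upper_vietoris (app X i) (indiscrete (app X i)))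
      (app (constant_responses I X) i)" if "mem i I" for i
  proof -
    have "elts (remove I i) \<subseteq> elts I"
      by auto
    then have "product_topology (remove I i) X ?T = indiscrete (product (remove I i) X)"
      by (rule product_topology_indiscrete[OF assms(1)]) (simp add: T)
    then show ?thesis
      using that nonempty app_constant_responses[OF assms(1) subset_refl that]
      by (simp add: continuous_indiscrete_const mem_hyperspace_indiscrete)
  qed
  then have "is_game (indiscrete_game I X)"
    unfolding is_game_def indiscrete_game_def using assms
    by (simp add: T function_on_lam_indiscrete topology_indiscrete
        function_on_constant_responses[OF assms(1) subset_refl])
  moreover have "\<exists>s. nash_equilibrium (reduction (indiscrete_game I X) J p) s"
    if J: "elts J \<subseteq> elts I" "finite_set J" and p: "mem p (product (as_set (elts I - elts J)) X)"
    for J p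
  proof -
    have "elts (product J X) \<noteq> {}"
      using assms(1) J by (rule finite_choice) (use J(1) nonempty in auto)
    then obtain s where s: "mem s (product J X)"
      by auto
    have "product J (restrict X J) = product J X"
      by (rule product_cong) (rule app_restrict[OF assms(1) J(1)])
    then have "nash_equilibrium (reduction (indiscrete_game I X) J p) s"
      using nash_equilibrium_constant_responses[OF assms(1) J(1) s]
        reduction_indiscrete_game[OF assms(1) J(1) p]
      by (simp add: reduction_def indiscrete_game_def)
    then show ?thesis
      by blast
  qed
  ultimately show ?thesis
    unfolding well_specified_def
    by (simp add: indiscrete_game_def T preregular_indiscrete compact_indiscrete)
qed

lemma choice_if_equilibria:
  assumes "\<And>G. well_specified G \<Longrightarrow> \<exists>s. nash_equilibrium G s"
  shows "choice"
  unfolding choice_def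
proof (intro allI impI, elim conjE)
  fix I X
  assume X: "function_on I X" "\<forall>i\<in>elts I. elts (app X i) \<noteq> {}"
  show "elts (product I X) \<noteq> {}"
  proof (cases "two_elements I")
    case True
    then obtain s where "nash_equilibrium (indiscrete_game I X) s"
      using assms well_specified_indiscrete_game[OF X(1)] X(2) by auto
    then show ?thesis
      unfolding nash_equilibrium_def indiscrete_game_def by auto
  next
    case False
    \<comment> \<open>With at most one index there is no game to apply the assumption to, but the
      family is finite.\<close>
    then have "elts I = {} \<or> (\<exists>i. elts I = {i})"
      unfolding two_elements_def by blast
    then have "I = as_set {} \<or> (\<exists>i. I = as_set {i})"
      by (metis as_set_elts)
    then have "finite_set I"
      using finite_set_empty finite_set_singleton by blast
    with X(1) subset_refl show ?thesis
      by (rule finite_choice) (use X(2) in auto)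
  qed
qed

end

theorem theorem5:
  fixes mem :: "'a \<Rightarrow> 'a \<Rightarrow> bool"
  assumes "ZF mem"
    and "\<And>G. membership.well_specified mem G \<Longrightarrow> \<exists>s. membership.nash_equilibrium mem G s"
  shows "membership.choice mem"
proof -
  interpret ZF mem
    by fact
  show ?thesis
    using assms(2) by (rule choice_if_equilibria)
qed

end
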